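(* Let $n=\ell+g$ with integers $\ell\ge 1$, $g\ge 1$, let $\mu\in\mathbb{R}$, $\sigma>0$, $0\le\alpha<1$, put $\beta=\ell/(2n)$ and $\gamma=\alpha-(1-2\beta)$, and consider one step of the voting model described in the context with $\ell$ egoists and a group of $g$ members following Principle B. Let $\widetilde d^{B}_{\mathcal G}$ be the actual capital increment in this step of an arbitrary fixed group member. Then $$M(\widetilde d^{B}_{\mathcal G})=\mu P_\alpha+\left(\mu P_G^B+\frac{\sigma f_G^B}{\sqrt g}\right)(P_\gamma-P_\alpha),$$ where $$P_G^B=\Phi\left(\frac{\mu\sqrt g}{\sigma}\right),\qquad f_G^B=\varphi\left(\frac{\mu\sqrt g}{\sigma}\right),\qquad P_\theta=\sum_{x=[\theta n]+1}^{\ell}b(x\mid\ell)\quad\text{for }\theta\in\{\alpha,\gamma\}.$$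
   Context: Voting model (one step). There are $n$ participants: $\ell$ egoists and $g=n-\ell$ group members. An environment proposal is a random vector $(d_1,\dots,d_n)$ whose components are mutually independent with distribution $N(\mu,\sigma^2)$. Egoist $i$ votes "for" if and only if $d_i>0$. All $g$ group members vote identically: all "for" or none "for", according to the group's principle. Principle B: the group votes "for" iff $\sum d_i>0$, the sum being over the group members. The proposal is accepted iff more than $\alpha n$ participants vote "for". If it is accepted, the actual capital increment of participant $i$ is $\widetilde d_i=d_i$; otherwise it is $\widetilde d_i=0$. Notation: $M(\cdot)$ is expectation; $\varphi$ and $\Phi$ are the density and the cumulative distribution function of $N(0,1)$; $p=\Phi(\mu/\sigma)$, $q=1-p$; $b(x\mid m)=\binom{m}{x}p^xq^{m-x}$, with $\binom{m}{x}=0$ for $x<0$ or $x>m$; $[t]$ is the integer part (floor) of $t$; a sum whose lower limit exceeds its upper limit is zero. *)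

theory Defs
  imports "HOL-Probability.Probability"
begin

definition Phi :: "real \<Rightarrow> real" where
  "Phi = cdf std_normal_distribution"

text \<open>Participants are numbered \<open>1, \<dots>, n\<close>; \<open>G\<close> is the set of group members, all other
  participants are egoists. A group principle maps the group and the proposal to the common vote
  of the group members.\<close>

type_synonym group_principle = "nat set \<Rightarrow> (nat \<Rightarrow> real) \<Rightarrow> bool"

definition principle_B :: group_principle where
  "principle_B G d \<longleftrightarrow> (\<Sum>j\<in>G. d j) > 0"

definition votes_for :: "group_principle \<Rightarrow> nat set \<Rightarrow> (nat \<Rightarrow> real) \<Rightarrow> nat \<Rightarrow> bool" where
  "votes_for R G d i \<longleftrightarrow> (if i \<in> G then R G d else d i > 0)"

definition accepted ::
    "group_principle \<Rightarrow> real \<Rightarrow> nat \<Rightarrow> nat set \<Rightarrow> (nat \<Rightarrow> real) \<Rightarrow> bool" where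
  "accepted R \<alpha> n G d \<longleftrightarrow> real (card {i \<in> {1..n}. votes_for R G d i}) > \<alpha> * real n"

definition actual_increment ::
    "group_principle \<Rightarrow> real \<Rightarrow> nat \<Rightarrow> nat set \<Rightarrow> (nat \<Rightarrow> real) \<Rightarrow> nat \<Rightarrow> real" where
  "actual_increment R \<alpha> n G d i = (if accepted R \<alpha> n G d then d i else 0)"

text \<open>The index is an integer since the lower summation limit below may be negative.\<close>

definition binom_prob :: "real \<Rightarrow> nat \<Rightarrow> int \<Rightarrow> real" where
  "binom_prob p m x =
     (if 0 \<le> x \<and> x \<le> int m then real (m choose nat x) * p ^ nat x * (1 - p) ^ (m - nat x) else 0)"

definition tail_prob :: "real \<Rightarrow> nat \<Rightarrow> nat \<Rightarrow> real \<Rightarrow> real" where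
  "tail_prob p n l \<theta> = (\<Sum>x = \<lfloor>\<theta> * real n\<rfloor> + 1..int l. binom_prob p l x)"

end

(* Let e be the number of egoists voting "for" and S the total proposal to the group. The proposal
   passes iff e > \<alpha> n, or S > 0 and e > \<alpha> n - g = \<gamma> n. Hence the increment of member i equals
   d_i 1[e > \<alpha> n] + d_i 1[S > 0] (1[e > \<gamma> n] - 1[e > \<alpha> n]). Since e is binomial and independent of
   the group's proposals, it remains to compute the mean of d_i 1[S > 0], which by exchangeability
   of the group members is the mean of S 1[S > 0] divided by g. *)

theory Submission
  imports Defs
begin

section \<open>Truncated moments of a single normal variable\<close>

text \<open>The function \<open>- std_normal_density\<close> is an antiderivative of the integrand
  on the half-line and vanishes at infinity, so only the boundary value at \<open>a\<close> remains.
  This is the source of the density term in the final formula.\<close>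

lemma std_normal_density_FTC:
  "(\<integral>x. std_normal_density x * (x * indicator {a<..} x) \<partial>lborel) = std_normal_density a"
proof -
  have "(LBINT x=ereal a..\<infinity>. std_normal_density x * x) = 0 - (- std_normal_density a)"
  proof (rule interval_integral_FTC_integrable[where F = "\<lambda>x. - std_normal_density x"])
    show "((\<lambda>x. - std_normal_density x) has_vector_derivative std_normal_density x * x) (at x)" for x
    proof -
      \<comment> \<open>Folding the normalising factor into an opaque constant leaves only the
        exponential to be differentiated.\<close>
      define c where "c = 1 / sqrt (2 * pi)"
      show ?thesis
        unfolding has_real_derivative_iff_has_vector_derivative[symmetric] std_normal_density_def c_def[symmetric]
        by (auto intro!: derivative_eq_intros)
    qed
    show "isCont (\<lambda>x. std_normal_density x * x) x" for x
      unfolding std_normal_density_def by (intro continuous_intros) auto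
    have "integrable lborel (\<lambda>x. std_normal_density x * x)"
      using integrable_std_normal_moment[of 1] by simp
    then show "set_integrable lborel (einterval (ereal a) \<infinity>) (\<lambda>x. std_normal_density x * x)"
      unfolding set_integrable_def by (intro integrable_mult_indicator) auto
    have "isCont (\<lambda>x. - std_normal_density x) a"
      unfolding std_normal_density_def by (intro continuous_intros) auto
    then show "(((\<lambda>x. - std_normal_density x) \<circ> real_of_ereal) \<longlongrightarrow> - std_normal_density a) (at_right (ereal a))"
      unfolding ereal_tendsto_simps1 by (simp add: isCont_def filterlim_at_split)
    have "(std_normal_density \<longlongrightarrow> 0) at_top"
      unfolding std_normal_density_def by real_asymp
    then show "(((\<lambda>x. - std_normal_density x) \<circ> real_of_ereal) \<longlongrightarrow> 0) (at_left \<infinity>)"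
      unfolding ereal_tendsto_simps1 using tendsto_minus by fastforce
  qed auto
  then show ?thesis
    by (simp add: interval_lebesgue_integral_def set_lebesgue_integral_def einterval_def
        greaterThan_def mult_ac indicator_def)
qed

context prob_space
begin

lemma expectation_of_bool:
  assumes "{\<omega>\<in>space M. P \<omega>} \<in> events"
  shows "expectation (\<lambda>\<omega>. of_bool (P \<omega>)) = prob {\<omega>\<in>space M. P \<omega>}"
proof -
  have "expectation (\<lambda>\<omega>. of_bool (P \<omega>)) = (\<integral>\<omega>. indicator {\<omega>\<in>space M. P \<omega>} \<omega> \<partial>M :: real)"
    by (intro Bochner_Integration.integral_cong) auto
  with assms show ?thesis
    by simp
qed

lemma prob_normal_positive:
  assumes X: "distributed M lborel X (normal_density m s)" and s: "0 < s"
  shows "prob {\<omega>\<in>space M. X \<omega> > 0} = Phi (m / s)"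
proof -
  \<comment> \<open>Standardising with a reflection, \<open>Z = (m - X) / s\<close>, turns
    \<open>X > 0\<close> into \<open>Z < m / s\<close>. The cdf then appears at \<open>m / s\<close>
    directly, and no symmetry of \<open>Phi\<close> has to be invoked.\<close>
  define Z where "Z = (\<lambda>\<omega>. m / s + (- 1 / s) * X \<omega>)"
  have Z: "distributed M lborel Z std_normal_density"
    unfolding Z_def using normal_density_affine[OF X s, of "- 1 / s" "m / s"] s by simp
  have Zm [measurable]: "Z \<in> borel_measurable M"
    using distributed_measurable[OF Z] by simp
  interpret N: real_distribution std_normal_distribution
    by (rule real_dist_normal_dist)
  have D: "distr M lborel Z = std_normal_distribution"
    using distributed_distr_eq_density[OF Z] .
  have "{\<omega>\<in>space M. X \<omega> > 0} = Z -` {..<m / s} \<inter> space M"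
    using s by (auto simp: Z_def divide_less_cancel simp flip: diff_divide_distrib)
  then have "prob {\<omega>\<in>space M. X \<omega> > 0} = measure std_normal_distribution {..<m / s}"
    by (simp add: D[symmetric] measure_distr)
  \<comment> \<open>The cdf measures the closed half-line; the endpoint is a null set because the
    law has a density.\<close>
  also have "\<dots> = measure std_normal_distribution {..m / s}"
  proof (rule measure_eq_AE)
    have "AE x in lborel. x \<noteq> m / s"
      by (rule AE_lborel_singleton)
    then show "AE x in std_normal_distribution. x \<in> {..<m / s} \<longleftrightarrow> x \<in> {..m / s}"
      by (subst AE_density) auto
  qed auto
  finally show ?thesis
    by (simp add: Phi_def cdf_def)
qed

text \<open>With \<open>X = m + s * Z\<close> and \<open>Z\<close> standard normal, the truncated
  mean splits into \<open>m\<close> times the probability of \<open>X > 0\<close> and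
  \<open>s\<close> times a truncated first moment of \<open>Z\<close>, which is known in closed
  form.\<close>

lemma expectation_normal_positive_part:
  assumes X: "distributed M lborel X (normal_density m s)" and s: "0 < s"
  shows "integrable M (\<lambda>\<omega>. X \<omega> * of_bool (X \<omega> > 0))"
    and "expectation (\<lambda>\<omega>. X \<omega> * of_bool (X \<omega> > 0)) = m * Phi (m / s) + s * std_normal_density (m / s)"
proof -
  have Xm [measurable]: "X \<in> borel_measurable M"
    using distributed_measurable[OF X] by simp
  have XI: "integrable M X"
    by (rule distributed_integrable_var[OF X]) (use s in \<open>auto simp: integrable_normal_moment_nz_1\<close>)
  define Z where "Z = (\<lambda>\<omega>. (X \<omega> - m) / s)"
  have Z: "distributed M lborel Z std_normal_density"
    unfolding Z_def using X normal_standard_normal_convert[OF s] by blast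
  have Zm [measurable]: "Z \<in> borel_measurable M"
    using distributed_measurable[OF Z] by simp
  have ZI: "integrable M Z"
    unfolding Z_def using XI by auto
  have bI: "integrable M (\<lambda>\<omega>. f \<omega> * of_bool (X \<omega> > 0))" if "integrable M f" for f :: "'a \<Rightarrow> real"
    by (rule Bochner_Integration.integrable_bound[OF that]) (use that in auto)
  show "integrable M (\<lambda>\<omega>. X \<omega> * of_bool (X \<omega> > 0))"
    by (rule bI[OF XI])
  have oI: "integrable M (\<lambda>\<omega>. of_bool (X \<omega> > 0) :: real)"
    using bI[of "\<lambda>_. 1"] by simp
  have "expectation (\<lambda>\<omega>. X \<omega> * of_bool (X \<omega> > 0))
      = expectation (\<lambda>\<omega>. m * of_bool (X \<omega> > 0) + s * (Z \<omega> * of_bool (X \<omega> > 0)))"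
    using s by (intro Bochner_Integration.integral_cong) (auto simp: Z_def)
  also have "\<dots> = m * expectation (\<lambda>\<omega>. of_bool (X \<omega> > 0)) + s * expectation (\<lambda>\<omega>. Z \<omega> * of_bool (X \<omega> > 0))"
    using oI bI[OF ZI] by simp
  also have "expectation (\<lambda>\<omega>. of_bool (X \<omega> > 0)) = prob {\<omega>\<in>space M. X \<omega> > 0}"
    by (rule expectation_of_bool) measurable
  also have "\<dots> = Phi (m / s)"
    by (rule prob_normal_positive[OF X s])
  also have "expectation (\<lambda>\<omega>. Z \<omega> * of_bool (X \<omega> > 0))
      = expectation (\<lambda>\<omega>. Z \<omega> * indicator {- m / s<..} (Z \<omega>))"
    using s by (intro Bochner_Integration.integral_cong) (auto simp: Z_def field_simps indicator_def)
  also have "\<dots> = std_normal_density (- m / s)"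
    by (subst distributed_integral[OF Z, symmetric]) (auto simp: std_normal_density_FTC)
  \<comment> \<open>The standard normal density is even.\<close>
  also have "\<dots> = std_normal_density (m / s)"
    by (simp add: std_normal_density_def power_divide)
  finally show "expectation (\<lambda>\<omega>. X \<omega> * of_bool (X \<omega> > 0)) = m * Phi (m / s) + s * std_normal_density (m / s)" .
qed

section \<open>Exchangeability of the summands of a normal sum\<close>

text \<open>By independence the law of \<open>(X i, \<Sum>j\<in>I - {i}. X j)\<close> is a product of two laws that do not
  depend on \<open>i\<close>, so every summand carries the same share of the truncated mean of the sum.\<close>

lemma expectation_summand_of_positive_normal_sum:
  fixes X :: "'i \<Rightarrow> 'a \<Rightarrow> real"
  assumes I: "finite I" "i \<in> I" and ind: "indep_vars (\<lambda>_. borel) X I" and s: "0 < s"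
    and X: "\<And>j. j \<in> I \<Longrightarrow> distributed M lborel (X j) (normal_density m s)"
  shows "expectation (\<lambda>\<omega>. X i \<omega> * of_bool ((\<Sum>j\<in>I. X j \<omega>) > 0))
    = m * Phi (m * sqrt (card I) / s)
      + s * std_normal_density (m * sqrt (card I) / s) / sqrt (card I)"
proof -
  let ?h = "\<lambda>j \<omega>. X j \<omega> * of_bool ((\<Sum>k\<in>I. X k \<omega>) > 0)"
  let ?T = "\<lambda>j \<omega>. \<Sum>k\<in>I - {j}. X k \<omega>"
  have Xm [measurable]: "X j \<in> borel_measurable M" if "j \<in> I" for j
    using distributed_measurable[OF X[OF that]] by simp
  have XI: "integrable M (X j)" if "j \<in> I" for j
    by (rule distributed_integrable_var[OF X[OF that]]) (use s in \<open>auto simp: integrable_normal_moment_nz_1\<close>)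
  have hI: "integrable M (?h j)" if "j \<in> I" for j
    by (rule Bochner_Integration.integrable_bound[OF XI[OF that]]) (use that in auto)
  have lawX: "distr M borel (X j) = density lborel (normal_density m s)" if "j \<in> I" for j
    using distributed_distr_eq_density[OF X[OF that]] by (simp cong: distr_cong)
  have lawT: "distr M borel (?T j) = distr M borel (?T i)" if j: "j \<in> I" for j
  \<comment> \<open>The theorem on sums of independent normal variables requires a nonempty index
    set. For a singleton \<open>I\<close> the remaining sum is empty and \<open>j = i\<close>, so
    the claim is trivial.\<close>
  proof (cases "I = {i}")
    case True
    with j show ?thesis by simp
  next
    case False
    \<comment> \<open>The omitted index \<open>k\<close> enters the mean and the variance only
      through the number \<open>card I - 1\<close> of remaining summands.\<close>
    have "distr M borel (?T k) = density lborel
        (normal_density (real (card I - 1) * m) (sqrt (real (card I - 1) * s\<^sup>2)))" if "k \<in> I" for k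
    proof -
      have "I - {k} \<noteq> {}"
        using False I that by auto
      then have "distributed M lborel (?T k)
          (normal_density (\<Sum>j\<in>I - {k}. m) (sqrt (\<Sum>j\<in>I - {k}. s\<^sup>2)))"
        using I s X by (intro sum_indep_normal indep_vars_subset[OF ind]) auto
      from distributed_distr_eq_density[OF this] show ?thesis
        using I that by (simp cong: distr_cong)
    qed
    with j I show ?thesis by simp
  qed
  have exch: "expectation (?h j) = expectation (?h i)" if j: "j \<in> I" for j
  proof -
    let ?f = "\<lambda>p :: real \<times> real. fst p * of_bool (fst p + snd p > 0)"
    have *: "expectation (?h k) = (\<integral>p. ?f p \<partial>(distr M borel (X i) \<Otimes>\<^sub>M distr M borel (?T i)))"
      if k: "k \<in> I" for k
    proof -
      have "indep_var borel (X k) borel (?T k)"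
        using I k by (intro indep_vars_sum) (auto simp: insert_absorb ind)
      then have "distr M borel (X k) \<Otimes>\<^sub>M distr M borel (?T k)
          = distr M (borel \<Otimes>\<^sub>M borel) (\<lambda>\<omega>. (X k \<omega>, ?T k \<omega>))"
        by (simp add: indep_var_distribution_eq)
      then have "(\<integral>p. ?f p \<partial>(distr M borel (X i) \<Otimes>\<^sub>M distr M borel (?T i)))
          = (\<integral>p. ?f p \<partial>(distr M (borel \<Otimes>\<^sub>M borel) (\<lambda>\<omega>. (X k \<omega>, ?T k \<omega>))))"
        using lawX[OF k] lawX[OF I(2)] lawT[OF k] by simp
      also have "\<dots> = expectation (\<lambda>\<omega>. ?f (X k \<omega>, ?T k \<omega>))"
        using k by (intro integral_distr) measurable
      also have "\<dots> = expectation (?h k)"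
        using I k by (simp add: sum.remove[of I k])
      finally show ?thesis ..
    qed
    show ?thesis
      using *[OF j] *[OF I(2)] by simp
  qed
  let ?c = "real (card I)"
  have c: "?c > 0"
    using I by (auto simp: card_gt_0_iff)
  have S: "distributed M lborel (\<lambda>\<omega>. \<Sum>j\<in>I. X j \<omega>) (normal_density (?c * m) (sqrt ?c * s))"
    using sum_indep_normal[OF I(1) _ ind, of "\<lambda>_. s" "\<lambda>_. m"] I s X by (auto simp: real_sqrt_mult)
  \<comment> \<open>Adding up the \<open>card I\<close> equal means recovers the truncated mean of
    the whole sum, a single normal variable with mean \<open>?c * m\<close> and standard deviation
    \<open>sqrt ?c * s\<close>.\<close>
  have "?c * expectation (?h i) = (\<Sum>j\<in>I. expectation (?h j))"
    using exch by simp
  also have "\<dots> = expectation (\<lambda>\<omega>. (\<Sum>j\<in>I. X j \<omega>) * of_bool ((\<Sum>j\<in>I. X j \<omega>) > 0))"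
    using hI by (simp add: sum_distrib_right)
  also have "\<dots> = ?c * m * Phi (?c * m / (sqrt ?c * s))
      + sqrt ?c * s * std_normal_density (?c * m / (sqrt ?c * s))"
    using c s by (intro expectation_normal_positive_part(2)[OF S]) auto
  also have "?c * m / (sqrt ?c * s) = m * sqrt ?c / s"
    using c s by (simp add: field_simps)
  finally have "?c * expectation (?h i) = ?c * (m * Phi (m * sqrt ?c / s)
      + s * std_normal_density (m * sqrt ?c / s) / sqrt ?c)"
    using c by (simp add: field_simps real_sqrt_mult_self)
  then show ?thesis
    using c by simp
qed

section \<open>Binomial law of the number of egoists voting "for"\<close>

text \<open>The event is partitioned according to the exact set \<open>A\<close> of indices with a
  positive value. By independence such a cell has a probability depending only on
  \<open>card A\<close>, and the binomial coefficient counts the sets of each size.\<close>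

lemma prob_card_positive_normals_greater:
  fixes X :: "'i \<Rightarrow> 'a \<Rightarrow> real"
  assumes L: "finite L" and ind: "indep_vars (\<lambda>_. borel) X L" and s: "0 < s"
    and X: "\<And>j. j \<in> L \<Longrightarrow> distributed M lborel (X j) (normal_density m s)"
  shows "prob {\<omega>\<in>space M. real (card {j\<in>L. X j \<omega> > 0}) > \<theta> * real n}
    = tail_prob (Phi (m / s)) n (card L) \<theta>"
proof -
  define p where "p = Phi (m / s)"
  define E where "E A = {\<omega>\<in>space M. {j\<in>L. X j \<omega> > 0} = A}" for A
  have Xm [measurable]: "X j \<in> borel_measurable M" if "j \<in> L" for j
    using distributed_measurable[OF X[OF that]] by simp
  have Em: "E A \<in> events" if "A \<subseteq> L" for A
  proof -
    have "E A = {\<omega>\<in>space M. \<forall>j\<in>L. X j \<omega> > 0 \<longleftrightarrow> j \<in> A}"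
      using that by (auto simp: E_def)
    also have "\<dots> \<in> events"
      using L by measurable
    finally show ?thesis .
  qed
  have probE: "prob (E A) = p ^ card A * (1 - p) ^ (card L - card A)" if A: "A \<subseteq> L" for A
  \<comment> \<open>The product formula for independent variables is applied to a nonempty index
    set; for empty \<open>L\<close> the only cell is the whole space.\<close>
  proof (cases "L = {}")
    case True
    with A show ?thesis by (simp add: E_def prob_space)
  next
    case False
    \<comment> \<open>\<open>B j\<close> is the half-line prescribed for \<open>X j\<close> by
      membership of \<open>j\<close> in \<open>A\<close>, so that the cell \<open>E A\<close> is an
      intersection of independent events.\<close>
    define B where "B j = (if j \<in> A then {0<..} else {..0::real})" for j
    have "E A = (\<Inter>j\<in>L. X j -` B j \<inter> space M)"
      using A False by (auto simp: E_def B_def not_less split: if_splits)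
    then have "prob (E A) = (\<Prod>j\<in>L. prob (X j -` B j \<inter> space M))"
      using indep_varsD_finite[OF ind False L, of B] by (simp add: B_def)
    also have "\<dots> = (\<Prod>j\<in>L. if j \<in> A then p else 1 - p)"
    proof (rule prod.cong)
      fix j assume j: "j \<in> L"
      have pos: "prob {\<omega>\<in>space M. X j \<omega> > 0} = p"
        unfolding p_def by (rule prob_normal_positive[OF X[OF j] s])
      have "prob {\<omega>\<in>space M. \<not> X j \<omega> > 0} = 1 - p"
        using j pos by (subst prob_neg) auto
      moreover have "X j -` B j \<inter> space M = {\<omega>\<in>space M. if j \<in> A then X j \<omega> > 0 else \<not> X j \<omega> > 0}"
        by (auto simp: B_def)
      ultimately show "prob (X j -` B j \<inter> space M) = (if j \<in> A then p else 1 - p)"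
        using pos by simp
    qed simp
    also have "\<dots> = p ^ card A * (1 - p) ^ card (L - A)"
      using L A by (simp add: prod.If_cases Int_absorb1 Diff_eq)
    also have "card (L - A) = card L - card A"
      using L A by (simp add: card_Diff_subset finite_subset)
    finally show ?thesis .
  qed
  let ?K = "{k\<in>{..card L}. real k > \<theta> * real n}"
  have "{\<omega>\<in>space M. real (card {j\<in>L. X j \<omega> > 0}) > \<theta> * real n}
      = (\<Union>A\<in>{A\<in>Pow L. real (card A) > \<theta> * real n}. E A)"
    by (auto simp: E_def)
  then have "prob {\<omega>\<in>space M. real (card {j\<in>L. X j \<omega> > 0}) > \<theta> * real n}
      = (\<Sum>A\<in>{A\<in>Pow L. real (card A) > \<theta> * real n}. prob (E A))"
    using L Em by (simp, intro finite_measure_finite_Union) (auto simp: disjoint_family_on_def E_def)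
  also have "\<dots> = (\<Sum>A\<in>{A\<in>Pow L. real (card A) > \<theta> * real n}. p ^ card A * (1 - p) ^ (card L - card A))"
    by (intro sum.cong) (auto simp: probE)
  also have "\<dots> = (\<Sum>k\<in>?K. \<Sum>A\<in>{A\<in>{A\<in>Pow L. real (card A) > \<theta> * real n}. card A = k}.
      p ^ card A * (1 - p) ^ (card L - card A))"
    using L by (intro sum.group[symmetric]) (auto simp: card_mono)
  also have "\<dots> = (\<Sum>k\<in>?K. binom_prob p (card L) (int k))"
  proof (rule sum.cong)
    fix k assume k: "k \<in> ?K"
    then have "{A\<in>{A\<in>Pow L. real (card A) > \<theta> * real n}. card A = k} = {A. A \<subseteq> L \<and> card A = k}"
      by auto
    then have "(\<Sum>A\<in>{A\<in>{A\<in>Pow L. real (card A) > \<theta> * real n}. card A = k}.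
        p ^ card A * (1 - p) ^ (card L - card A))
        = (\<Sum>A\<in>{A. A \<subseteq> L \<and> card A = k}. p ^ k * (1 - p) ^ (card L - k))"
      by (intro sum.cong) auto
    then show "(\<Sum>A\<in>{A\<in>{A\<in>Pow L. real (card A) > \<theta> * real n}. card A = k}.
        p ^ card A * (1 - p) ^ (card L - card A)) = binom_prob p (card L) (int k)"
      using k L by (simp add: n_subsets binom_prob_def)
  qed simp
  also have "\<dots> = (\<Sum>x\<in>int ` ?K. binom_prob p (card L) x)"
    by (simp add: sum.reindex)
  also have "\<dots> = tail_prob p n (card L) \<theta>"
    unfolding tail_prob_def
  proof (rule sum.mono_neutral_left)
    \<comment> \<open>A strict bound on an integer by a real threshold starts counting at the floor
      plus one, also when the threshold is itself an integer or is negative.\<close>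
    have gt: "real k > t \<longleftrightarrow> int k \<ge> \<lfloor>t\<rfloor> + 1" for k :: nat and t
      by linarith
    show "int ` ?K \<subseteq> {\<lfloor>\<theta> * real n\<rfloor> + 1..int (card L)}"
      by (auto simp: gt)
    show "\<forall>x\<in>{\<lfloor>\<theta> * real n\<rfloor> + 1..int (card L)} - int ` ?K. binom_prob p (card L) x = 0"
    proof
      fix x assume x: "x \<in> {\<lfloor>\<theta> * real n\<rfloor> + 1..int (card L)} - int ` ?K"
      \<comment> \<open>The integer range exceeds the image of \<open>?K\<close> only when the lower
        limit is negative; there \<open>binom_prob\<close> has the value 0 by convention.\<close>
      have "x < 0"
      proof (rule ccontr)
        assume "\<not> x < 0"
        then have "x = int (nat x)" by simp
        with x have "nat x \<in> ?K" by (auto simp: gt)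
        with x \<open>x = int (nat x)\<close> show False by blast
      qed
      then show "binom_prob p (card L) x = 0"
        by (simp add: binom_prob_def)
    qed
  qed simp
  finally show ?thesis
    by (simp add: p_def)
qed

section \<open>Factorisation over disjoint blocks of independent variables\<close>

text \<open>Functions of disjoint blocks of an independent family are independent, so the mean of
  their product factors. It is meant for \<open>A\<close> the group and \<open>B\<close> the
  egoists: \<open>u\<close> is a quantity determined by the group's proposals, \<open>Q\<close> a
  condition on the egoists' votes.\<close>

lemma expectation_times_indep_event:
  fixes X :: "'i \<Rightarrow> 'a \<Rightarrow> real"
  assumes ind: "indep_vars (\<lambda>_. borel) X J" and AB: "A \<inter> B = {}" "A \<subseteq> J" "B \<subseteq> J"
    and u [measurable]: "u \<in> borel_measurable (PiM A (\<lambda>_. borel))"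
    and Q [measurable]: "Measurable.pred (PiM B (\<lambda>_. borel)) Q"
    and uI: "integrable M (\<lambda>\<omega>. u (restrict (\<lambda>j. X j \<omega>) A) :: real)"
  shows "integrable M (\<lambda>\<omega>. u (restrict (\<lambda>j. X j \<omega>) A) * of_bool (Q (restrict (\<lambda>j. X j \<omega>) B)))"
    and "expectation (\<lambda>\<omega>. u (restrict (\<lambda>j. X j \<omega>) A) * of_bool (Q (restrict (\<lambda>j. X j \<omega>) B)))
      = expectation (\<lambda>\<omega>. u (restrict (\<lambda>j. X j \<omega>) A)) * prob {\<omega>\<in>space M. Q (restrict (\<lambda>j. X j \<omega>) B)}"
proof -
  have rv: "random_variable (PiM B (\<lambda>_. borel)) (\<lambda>\<omega>. restrict (\<lambda>j. X j \<omega>) B)"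
    using indep_var_rv2[OF indep_var_restrict[OF ind AB]] .
  note [measurable] = rv
  have iv: "indep_var borel (\<lambda>\<omega>. u (restrict (\<lambda>j. X j \<omega>) A))
      borel (\<lambda>\<omega>. of_bool (Q (restrict (\<lambda>j. X j \<omega>) B)) :: real)"
    using indep_var_compose[OF indep_var_restrict[OF ind AB] u,
        of "\<lambda>f. of_bool (Q f) :: real" borel] by (simp add: comp_def)
  have bI: "integrable M (\<lambda>\<omega>. of_bool (Q (restrict (\<lambda>j. X j \<omega>) B)) :: real)"
    by (rule integrable_const_bound[where B = 1]) auto
  have bE: "expectation (\<lambda>\<omega>. of_bool (Q (restrict (\<lambda>j. X j \<omega>) B)))
      = prob {\<omega>\<in>space M. Q (restrict (\<lambda>j. X j \<omega>) B)}"
    by (rule expectation_of_bool) measurable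
  show "integrable M (\<lambda>\<omega>. u (restrict (\<lambda>j. X j \<omega>) A) * of_bool (Q (restrict (\<lambda>j. X j \<omega>) B)))"
    by (rule indep_var_integrable[OF iv uI bI])
  show "expectation (\<lambda>\<omega>. u (restrict (\<lambda>j. X j \<omega>) A) * of_bool (Q (restrict (\<lambda>j. X j \<omega>) B)))
      = expectation (\<lambda>\<omega>. u (restrict (\<lambda>j. X j \<omega>) A)) * prob {\<omega>\<in>space M. Q (restrict (\<lambda>j. X j \<omega>) B)}"
    using indep_var_lebesgue_integral[OF iv uI bI] by (simp add: bE)
qed

end

section \<open>The increment of a group member under Principle B\<close>

text \<open>The group adds either all of its \<open>card G\<close> votes to \<open>e\<close> or
  none; if it votes "for", the first and the last term cancel. Each of the three terms is a function
  of the group's proposals times an indicator depending on the egoists alone, the form in which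
  independence applies.\<close>

lemma actual_increment_principle_B:
  fixes d :: "nat \<Rightarrow> real"
  assumes "G \<subseteq> {1..n}"
  defines "e \<equiv> real (card {j\<in>{1..n} - G. d j > 0})"
  shows "actual_increment principle_B \<alpha> n G d i
    = d i * of_bool (e > \<alpha> * real n)
      + (d i * of_bool ((\<Sum>j\<in>G. d j) > 0) * of_bool (e > \<alpha> * real n - real (card G))
        - d i * of_bool ((\<Sum>j\<in>G. d j) > 0) * of_bool (e > \<alpha> * real n))"
proof -
  have "{j\<in>{1..n}. votes_for principle_B G d j}
      = {j\<in>{1..n} - G. d j > 0} \<union> (if (\<Sum>j\<in>G. d j) > 0 then G else {})"
    using assms by (auto simp: votes_for_def principle_B_def)
  moreover have "card ({j\<in>{1..n} - G. d j > 0} \<union> G) = card {j\<in>{1..n} - G. d j > 0} + card G"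
    using assms finite_subset[OF assms(1)] by (intro card_Un_disjoint) auto
  ultimately have "real (card {j\<in>{1..n}. votes_for principle_B G d j})
      = e + real (card G) * of_bool ((\<Sum>j\<in>G. d j) > 0)"
    by (simp add: e_def)
  then show ?thesis
    by (auto simp: actual_increment_def accepted_def)
qed

theorem mainTheorem3:
  fixes M :: "'a measure" and d :: "nat \<Rightarrow> 'a \<Rightarrow> real"
    and n l g i :: nat and G :: "nat set"
    and \<mu> \<sigma> \<alpha> \<beta> \<gamma> p PG fG :: real
  assumes "prob_space M"
    and "n = l + g" and "l \<ge> 1" and "g \<ge> 1"
    and "\<sigma> > 0" and "0 \<le> \<alpha>" and "\<alpha> < 1"
    and "\<beta> = real l / (2 * real n)"
    and "\<gamma> = \<alpha> - (1 - 2 * \<beta>)"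
    and "G \<subseteq> {1..n}" and "card G = g"
    and "prob_space.indep_vars M (\<lambda>_. borel) d {1..n}"
    and "\<And>j. j \<in> {1..n} \<Longrightarrow> distributed M lborel (d j) (normal_density \<mu> \<sigma>)"
    and "p = Phi (\<mu> / \<sigma>)"
    and "PG = Phi (\<mu> * sqrt (real g) / \<sigma>)"
    and "fG = std_normal_density (\<mu> * sqrt (real g) / \<sigma>)"
    and "i \<in> G"
  shows "integrable M (\<lambda>\<omega>. actual_increment principle_B \<alpha> n G (\<lambda>j. d j \<omega>) i)
    \<and> prob_space.expectation M (\<lambda>\<omega>. actual_increment principle_B \<alpha> n G (\<lambda>j. d j \<omega>) i) =
        \<mu> * tail_prob p n l \<alpha>
        + (\<mu> * PG + \<sigma> * fG / sqrt (real g)) * (tail_prob p n l \<gamma> - tail_prob p n l \<alpha>)"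
proof -
  interpret prob_space M by fact
  note ind = assms(12) and norm = assms(13) and \<sigma> = assms(5)
  let ?L = "{1..n} - G"
  let ?e = "\<lambda>\<omega>. real (card {j\<in>?L. d j \<omega> > 0})"
  let ?S = "\<lambda>\<omega>. \<Sum>j\<in>G. d j \<omega>"
  have finG: "finite G"
    using assms(10) finite_subset by blast
  have cardL: "card ?L = l"
    using assms(2,10,11) finG by (simp add: card_Diff_subset)
  have i: "i \<in> {1..n}"
    using assms(10,17) by blast
  have indG: "indep_vars (\<lambda>_. borel) d G" and indL: "indep_vars (\<lambda>_. borel) d ?L"
    by (rule indep_vars_subset[OF ind], use assms(10) in auto)+
  \<comment> \<open>Since \<open>2 * \<beta>\<close> is the share of egoists,
    \<open>1 - 2 * \<beta>\<close> is the share \<open>g / n\<close> of the group. Thus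
    \<open>\<gamma>\<close> is the acceptance threshold left to the egoists once the group votes
    "for".\<close>
  have \<gamma>n: "\<gamma> * real n = \<alpha> * real n - real g"
  proof -
    have "\<beta> * (2 * real n) = real l"
      using assms(2,3,8) by simp
    moreover have "\<gamma> * real n = \<alpha> * real n - real n + \<beta> * (2 * real n)"
      by (simp add: assms(9) algebra_simps)
    ultimately show ?thesis
      by (simp add: assms(2))
  qed
  have dm [measurable]: "d j \<in> borel_measurable M" if "j \<in> {1..n}" for j
    using distributed_measurable[OF norm[OF that]] by simp
  have dI: "integrable M (d i)"
    by (rule distributed_integrable_var[OF norm[OF i]]) (use \<sigma> in \<open>auto simp: integrable_normal_moment_nz_1\<close>)
  have Sm [measurable]: "?S \<in> borel_measurable M"
    using assms(10) by (intro borel_measurable_sum dm) auto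
  have dSI: "integrable M (\<lambda>\<omega>. d i \<omega> * of_bool (?S \<omega> > 0))"
    by (rule Bochner_Integration.integrable_bound[OF dI]) (use i in auto)
  have Ed: "expectation (d i) = \<mu>"
    by (rule normal_distributed_expectation[OF \<sigma> norm[OF i]])
  have EdS: "expectation (\<lambda>\<omega>. d i \<omega> * of_bool (?S \<omega> > 0)) = \<mu> * PG + \<sigma> * fG / sqrt (real g)"
    unfolding assms(15,16) assms(11)[symmetric]
    by (rule expectation_summand_of_positive_normal_sum[OF finG assms(17) indG \<sigma> norm]) (use assms(10) in auto)
  have tail: "prob {\<omega>\<in>space M. ?e \<omega> > \<theta> * real n} = tail_prob p n l \<theta>" for \<theta>
    using prob_card_positive_normals_greater[OF _ indL \<sigma>, of \<mu> \<theta> n] norm cardL assms(14) by auto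
  have sub: "G \<inter> ?L = {}" "G \<subseteq> {1..n}" "?L \<subseteq> {1..n}"
    using assms(10) by auto
  have Q: "Measurable.pred (PiM ?L (\<lambda>_. borel)) (\<lambda>f. real (card {j\<in>?L. f j > (0::real)}) > t)" for t
  proof -
    \<comment> \<open>Written as a finite sum of indicators, the count is visibly measurable in the
      coordinates.\<close>
    have "real (card {j\<in>?L. f j > (0::real)}) = (\<Sum>j\<in>?L. of_bool (f j > 0))" for f
      by (simp add: of_bool_def sum.If_cases Int_def)
    then show ?thesis
      by (simp only:) measurable
  qed
  \<comment> \<open>Here the group factor is the coordinate projection at \<open>i\<close>, which
    belongs to the block \<open>G\<close>.\<close>
  have d_part: "integrable M (\<lambda>\<omega>. d i \<omega> * of_bool (?e \<omega> > t))"
    "expectation (\<lambda>\<omega>. d i \<omega> * of_bool (?e \<omega> > t)) = expectation (d i) * prob {\<omega>\<in>space M. ?e \<omega> > t}" for t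
    using expectation_times_indep_event[OF ind sub, of "\<lambda>f. f i", OF _ Q[of t]] assms(17) dI
    by (simp_all cong: conj_cong)
  \<comment> \<open>The truncated increment also depends on the coordinates in \<open>G\<close>
    only, so the same factorisation applies to it.\<close>
  have dS_part: "integrable M (\<lambda>\<omega>. d i \<omega> * of_bool (?S \<omega> > 0) * of_bool (?e \<omega> > t))"
    "expectation (\<lambda>\<omega>. d i \<omega> * of_bool (?S \<omega> > 0) * of_bool (?e \<omega> > t))
      = expectation (\<lambda>\<omega>. d i \<omega> * of_bool (?S \<omega> > 0)) * prob {\<omega>\<in>space M. ?e \<omega> > t}" for t
    using expectation_times_indep_event[OF ind sub, of "\<lambda>f. f i * of_bool ((\<Sum>j\<in>G. f j) > 0)", OF _ Q[of t]]
      assms(17) dSI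
    by (simp_all cong: conj_cong)
  \<comment> \<open>The three terms have means \<open>\<mu>\<close> times the tail at
    \<open>\<alpha>\<close>, and \<open>\<mu> * PG + \<sigma> * fG / sqrt (real g)\<close> times the
    tails at \<open>\<gamma>\<close> and at \<open>\<alpha>\<close>, the last one
    subtracted.\<close>
  show ?thesis
    unfolding actual_increment_principle_B[OF assms(10)] assms(11) \<gamma>n[symmetric]
    by (intro conjI)
       (simp_all only: Bochner_Integration.integral_add Bochner_Integration.integral_diff
          Bochner_Integration.integrable_add Bochner_Integration.integrable_diff
          d_part dS_part tail Ed EdS, simp add: algebra_simps)
qed

end
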